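(* Let $p$ be a positive integer and let $(\mathbf{A}_n)_{n\in\mathbb{N}}$ be a sequence of matrices in $\mathbb{C}^{p\times p}$ determining a $Fib_p$ recurrence whose kneading matrix $\mathbf{K}$ is holomorphic on some open disk $D_\rho$ with $\rho>1$. Let $\lambda_1,\dots,\lambda_m$ be the (distinct) dominant eigenvalues of the recurrence, with multiplicities $\mathrm{mul}(\lambda_1),\dots,\mathrm{mul}(\lambda_m)$. Then for any solution $\Theta(\boldsymbol{u})=(\mathrm{v}_n)_{n\in\mathbb{Z}}$, $\mathrm{v}_n=(\mathrm{v}_n^{(1)},\dots,\mathrm{v}_n^{(p)})$, with $\boldsymbol{u}\in\boldsymbol{U}$, and every $\alpha=1,\dots,p$, there exist unique constants $c_{i,j}^{(\alpha)}(\boldsymbol{u})\in\mathbb{C}$, with $i=1,\dots,m$ and $j=1,\dots,\mathrm{mul}(\lambda_i)$, such that $$\lim_{n\to+\infty}\left(\mathrm{v}_n^{(\alpha)}-\sum_{i=1}^m\sum_{j=1}^{\mathrm{mul}(\lambda_i)}\frac{c_{i,j}^{(\alpha)}(\boldsymbol{u})\,(n+j-1)!}{(j-1)!\,n!}\lambda_i^n\right)=0.$$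
   Context: $\mathbb{N}=\{0,1,2,\dots\}$. The $Fib_p$ recurrence determined by $(\mathbf{A}_n)_{n\in\mathbb{N}}$ is $\mathrm{x}_{n+1}=\sum_{i=0}^{+\infty}\mathbf{A}_i\mathrm{x}_{n-i}$, $n\in\mathbb{N}$, where $\mathrm{x}_n\in\mathbb{C}^p$ for all $n\in\mathbb{Z}$ and $\mathrm{x}_n=0$ for all but finitely many negative $n$. Let $\boldsymbol{U}=\bigoplus_{n\in\mathbb{N}}\mathbb{C}^p$ (sequences $\boldsymbol{u}=(\mathrm{u}_0,\mathrm{u}_1,\dots)$ in $\mathbb{C}^p$ with finitely many nonzero terms), the space of initial conditions. For $\boldsymbol{u}\in\boldsymbol{U}$, the solution with initial condition $\boldsymbol{u}$ is the unique sequence $\Theta(\boldsymbol{u})=(\mathrm{v}_n)_{n\in\mathbb{Z}}$ in $\mathbb{C}^p$ with $\mathrm{v}_n=\mathrm{u}_{-n}$ for all $n\le0$ and $\mathrm{v}_{n+1}=\sum_{i=0}^{+\infty}\mathbf{A}_i\mathrm{v}_{n-i}$ for all $n\ge0$; $\mathrm{v}_n^{(\alpha)}$ is the $\alpha$-th coordinate of $\mathrm{v}_n$. Every solution of the recurrence is of this form. The kneading matrix is $\mathbf{K}=(K(i,j))\in\mathbb{C}[[z]]^{p\times p}$ with $K(i,j)=\sum_{n\ge0}A_n(i,j)z^n$, where $A_n(i,j)$ is the $(i,j)$ entry of $\mathbf{A}_n$; the kneading determinant is $\Delta=\det(\mathbf{I}-z\mathbf{K})$. For $\rho\in\,]0,+\infty]$,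 $D_\rho=\{z\in\mathbb{C}:|z|<\rho\}$, and $\mathbf{K}$ is holomorphic on $D_\rho$ if each of the power series $K(i,j)$ has radius of convergence at least $\rho$; in that case $\Delta$ is regarded as an analytic function on $D_\rho$. When $\mathbf{K}$ is holomorphic on $D_\rho$, a complex number $\lambda$ with $|\lambda|>\rho^{-1}$ is a generalized eigenvalue of the recurrence with multiplicity $\mathrm{mul}(\lambda)\in\mathbb{Z}^+$ if $\Delta$ has a zero of order $\mathrm{mul}(\lambda)$ at $\lambda^{-1}$. A generalized eigenvalue $\lambda$ is dominant if $|\lambda|\ge1$. (When $\rho>1$ there are finitely many dominant eigenvalues.) *)

theory Defs
  imports "HOL-Complex_Analysis.Complex_Analysis"
begin

definition initial_conditions :: "(nat \<Rightarrow> complex ^ 'p) set" where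
  "initial_conditions = {u. finite {n. u n \<noteq> 0}}"

text \<open>
  When \<open>u\<close> has finite support, only finitely many terms of the series below are nonzero.
\<close>

definition solution_with_initial_condition ::
    "(nat \<Rightarrow> complex ^ 'p ^ 'p) \<Rightarrow> (nat \<Rightarrow> complex ^ 'p) \<Rightarrow> (int \<Rightarrow> complex ^ 'p) \<Rightarrow> bool" where
  "solution_with_initial_condition A u v \<longleftrightarrow>
     (\<forall>n\<le>0. v n = u (nat (- n))) \<and>
     (\<forall>n\<ge>0. v (n + 1) = (\<Sum>i. A i *v v (n - int i)))"

lemma ex1_solution_with_initial_condition:
  "\<exists>!v. solution_with_initial_condition A u v"
proof -
  define g where "g = rec_nat (\<lambda>n::int. if n \<le> 0 then u (nat (- n)) else 0)
     (\<lambda>n h. h(int n + 1 := (\<Sum>i. A i *v h (int n - int i))))"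
  have g0: "g 0 = (\<lambda>n. if n \<le> 0 then u (nat (- n)) else 0)"
    and gS: "\<And>n. g (Suc n) = (g n)(int n + 1 := (\<Sum>i. A i *v g n (int n - int i)))"
    by (simp_all add: g_def)
  have stable: "g (nat k + d) k = g (nat k) k" for k :: int and d
    by (induction d) (auto simp: gS)
  define v where "v = (\<lambda>k. g (nat k) k)"
  have v_eq: "v k = g n k" if "k \<le> int n" for k n
    using stable[of k "n - nat k"] that by (simp add: v_def)
  have "solution_with_initial_condition A u v"
    unfolding solution_with_initial_condition_def
  proof (intro conjI allI impI)
    fix n :: int assume n: "n \<ge> 0"
    have "nat (n + 1) = Suc (nat n)" using n by simp
    hence "v (n + 1) = (\<Sum>i. A i *v g (nat n) (n - int i))"
      using n by (simp add: v_def gS)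
    also have "\<dots> = (\<Sum>i. A i *v v (n - int i))"
      using n by (intro arg_cong[where f = suminf] ext) (simp add: v_eq[of _ "nat n"])
    finally show "v (n + 1) = (\<Sum>i. A i *v v (n - int i))" .
  qed (simp add: v_def g0)
  moreover have "w = w'"
    if w: "solution_with_initial_condition A u w" and w': "solution_with_initial_condition A u w'"
    for w w'
  proof -
    have *: "\<forall>k\<le>int n. w k = w' k" for n
    proof (induction n)
      case 0
      thus ?case using w w' by (simp add: solution_with_initial_condition_def)
    next
      case (Suc n)
      have "w (int n + 1) = (\<Sum>i. A i *v w (int n - int i))"
        using w by (simp add: solution_with_initial_condition_def)
      also have "\<dots> = (\<Sum>i. A i *v w' (int n - int i))"
        using Suc.IH by simp
      also have "\<dots> = w' (int n + 1)"
        using w' by (simp add: solution_with_initial_condition_def)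
      finally have step: "w (int n + 1) = w' (int n + 1)" .
      show ?case
      proof (intro allI impI)
        fix k assume "k \<le> int (Suc n)"
        hence "k \<le> int n \<or> k = int n + 1" by linarith
        thus "w k = w' k" using Suc.IH step by blast
      qed
    qed
    show "w = w'"
      using *[of "nat k" for k] by (intro ext) (metis nat_le_iff order_refl)
  qed
  ultimately show ?thesis by blast
qed

definition Theta ::
    "(nat \<Rightarrow> complex ^ 'p ^ 'p) \<Rightarrow> (nat \<Rightarrow> complex ^ 'p) \<Rightarrow> int \<Rightarrow> complex ^ 'p" where
  "Theta A u = (THE v. solution_with_initial_condition A u v)"

lemma solution_Theta: "solution_with_initial_condition A u (Theta A u)"
  unfolding Theta_def
  using theI'[OF ex1_solution_with_initial_condition[of A u]] .

definition kneading_matrix :: "(nat \<Rightarrow> complex ^ 'p ^ 'p) \<Rightarrow> complex fps ^ 'p ^ 'p" where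
  "kneading_matrix A = (\<chi> i j. Abs_fps (\<lambda>n. A n $ i $ j))"

definition kneading_determinant :: "(nat \<Rightarrow> complex ^ 'p ^ 'p) \<Rightarrow> complex fps" where
  "kneading_determinant A = det (mat 1 - (\<chi> i j. fps_X * kneading_matrix A $ i $ j))"

definition kneading_matrix_holomorphic :: "(nat \<Rightarrow> complex ^ 'p ^ 'p) \<Rightarrow> ereal \<Rightarrow> bool" where
  "kneading_matrix_holomorphic A \<rho> \<longleftrightarrow> (\<forall>i j. \<rho> \<le> fps_conv_radius (kneading_matrix A $ i $ j))"

lemma kneading_determinant_nth_0: "fps_nth (kneading_determinant A) 0 = 1"
proof -
  let ?M = "mat 1 - (\<chi> i j. fps_X * kneading_matrix A $ i $ j)"
  have sum0: "fps_nth (sum f S) 0 = (\<Sum>x\<in>S. fps_nth (f x) 0)" for f :: "'b \<Rightarrow> complex fps" and S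
    by (simp add: fps_sum_nth)
  have prod0: "fps_nth (prod f S) 0 = (\<Prod>x\<in>S. fps_nth (f x) 0)"
    for f :: "'c \<Rightarrow> complex fps" and S
    by (induction S rule: infinite_finite_induct) auto
  have int0: "fps_nth (of_int k * f) 0 = of_int k * fps_nth f 0" for k and f :: "complex fps"
    by (simp add: fps_of_int[symmetric])
  have entry: "fps_nth (?M $ i $ j) 0 = (mat 1 :: complex ^ 'a ^ 'a) $ i $ j" for i j
    by (simp add: mat_def)
  have "fps_nth (det ?M) 0 = det (mat 1 :: complex ^ 'a ^ 'a)"
    unfolding det_def sum0 int0 prod0 entry ..
  thus ?thesis by (simp add: kneading_determinant_def)
qed

lemma fps_conv_radius_kneading_determinant:
  assumes "kneading_matrix_holomorphic A \<rho>"
  shows   "\<rho> \<le> fps_conv_radius (kneading_determinant A)"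
proof -
  let ?M = "mat 1 - (\<chi> i j. fps_X * kneading_matrix A $ i $ j)"
  have mult: "\<rho> \<le> fps_conv_radius (f * g)"
    if "\<rho> \<le> fps_conv_radius f" "\<rho> \<le> fps_conv_radius g" for f g :: "complex fps"
    using that fps_conv_radius_mult[of f g] by (meson min.boundedI order_trans)
  have diff: "\<rho> \<le> fps_conv_radius (f - g)"
    if "\<rho> \<le> fps_conv_radius f" "\<rho> \<le> fps_conv_radius g" for f g :: "complex fps"
    using that fps_conv_radius_diff[of f g] by (meson min.boundedI order_trans)
  have add: "\<rho> \<le> fps_conv_radius (f + g)"
    if "\<rho> \<le> fps_conv_radius f" "\<rho> \<le> fps_conv_radius g" for f g :: "complex fps"
    using that fps_conv_radius_add[of f g] by (meson min.boundedI order_trans)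
  have sum: "\<rho> \<le> fps_conv_radius (sum f S)"
    if "\<And>x. \<rho> \<le> fps_conv_radius (f x)" for f :: "'b \<Rightarrow> complex fps" and S
    by (induction S rule: infinite_finite_induct) (auto intro: add that)
  have prod: "\<rho> \<le> fps_conv_radius (prod f S)"
    if "\<And>x. \<rho> \<le> fps_conv_radius (f x)" for f :: "'c \<Rightarrow> complex fps" and S
    by (induction S rule: infinite_finite_induct) (auto intro: mult that)
  have int: "\<rho> \<le> fps_conv_radius (of_int k :: complex fps)" for k
    by (simp add: fps_of_int[symmetric])
  have entry: "\<rho> \<le> fps_conv_radius (?M $ i $ j)" for i j
    using assms by (auto simp: mat_def kneading_matrix_holomorphic_def
                         simp del: diff_0 intro!: diff mult)
  show ?thesis
    unfolding kneading_determinant_def det_def by (intro sum mult prod int entry)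
qed

text \<open>
  \<open>k\<close> is the multiplicity, which is unique for given \<open>\<mu>\<close>.
  The function \<^const>\<open>zorder\<close> is a meaningful order only where the function is not locally
  zero, whence \<^const>\<open>isolated_zero\<close>.
\<close>

definition generalized_eigenvalue ::
    "(nat \<Rightarrow> complex ^ 'p ^ 'p) \<Rightarrow> ereal \<Rightarrow> complex \<Rightarrow> nat \<Rightarrow> bool" where
  "generalized_eigenvalue A \<rho> \<mu> k \<longleftrightarrow>
     inverse \<rho> < ereal (norm \<mu>) \<and> 0 < k \<and>
     isolated_zero (eval_fps (kneading_determinant A)) (inverse \<mu>) \<and>
     zorder (eval_fps (kneading_determinant A)) (inverse \<mu>) = int k"

definition dominant_eigenvalue ::
    "(nat \<Rightarrow> complex ^ 'p ^ 'p) \<Rightarrow> ereal \<Rightarrow> complex \<Rightarrow> nat \<Rightarrow> bool" where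
  "dominant_eigenvalue A \<rho> \<mu> k \<longleftrightarrow> generalized_eigenvalue A \<rho> \<mu> k \<and> 1 \<le> norm \<mu>"

lemma generalized_eigenvalue_iff_zero:
  assumes "0 < \<rho>" and hol: "kneading_matrix_holomorphic A \<rho>" and l: "inverse \<rho> < ereal (norm \<mu>)"
  shows   "(\<exists>k. generalized_eigenvalue A \<rho> \<mu> k) \<longleftrightarrow>
             eval_fps (kneading_determinant A) (inverse \<mu>) = 0"
proof -
  let ?f = "eval_fps (kneading_determinant A)"
  have sub: "eball 0 \<rho> \<subseteq> eball 0 (fps_conv_radius (kneading_determinant A))"
    using fps_conv_radius_kneading_determinant[OF hol] by (auto simp: eball_def)
  have holo: "?f holomorphic_on eball 0 \<rho>"
    by (intro holomorphic_on_eval_fps sub)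
  have l0: "\<mu> \<noteq> 0"
    using l \<open>0 < \<rho>\<close> by (cases \<rho>) (auto simp: zero_ereal_def)
  have mem: "inverse \<mu> \<in> eball 0 \<rho>"
    using l l0 \<open>0 < \<rho>\<close>
    by (cases \<rho>) (auto simp: eball_def norm_inverse norm_divide field_simps)
  have ana: "?f analytic_on {inverse \<mu>}"
    using holo mem by (meson analytic_at open_eball)
  have f0: "?f 0 \<noteq> 0"
    by (simp add: eval_fps_at_0 kneading_determinant_nth_0)
  show ?thesis
  proof
    assume "\<exists>k. generalized_eigenvalue A \<rho> \<mu> k"
    thus "?f (inverse \<mu>) = 0"
      using ana zero_isolated_zero_analytic by (auto simp: generalized_eigenvalue_def)
  next
    assume z: "?f (inverse \<mu>) = 0"
    have iso: "isolated_zero ?f (inverse \<mu>)"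
    proof -
      have conn: "connected (eball (0::complex) \<rho>)" by (rule connected_eball)
      have "0 \<in> eball (0::complex) \<rho>" using \<open>0 < \<rho>\<close> by (simp add: zero_ereal_def)
      then have "eventually (\<lambda>w. ?f w \<noteq> 0) (at (inverse \<mu>))"
        using non_zero_neighbour_alt[OF holo open_eball conn mem _ f0]
        by (auto elim: eventually_mono)
      thus ?thesis using z ana by (simp add: isolated_zero_analytic_iff)
    qed
    moreover have "zorder ?f (inverse \<mu>) > 0"
      using iso ana zorder_isolated_zero_pos by blast
    ultimately show "\<exists>k. generalized_eigenvalue A \<rho> \<mu> k"
      using l by (intro exI[of _ "nat (zorder ?f (inverse \<mu>))"])
                 (auto simp: generalized_eigenvalue_def)
  qed
qed

lemma finite_dominant_eigenvalues:
  assumes "1 < \<rho>" and hol: "kneading_matrix_holomorphic A \<rho>"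
  shows   "finite {\<mu>. \<exists>k. dominant_eigenvalue A \<rho> \<mu> k}"
proof -
  let ?f = "eval_fps (kneading_determinant A)"
  have \<rho>0: "0 < \<rho>" using \<open>1 < \<rho>\<close> by (cases \<rho>) (auto simp: one_ereal_def zero_ereal_def)
  have sub: "eball 0 \<rho> \<subseteq> eball 0 (fps_conv_radius (kneading_determinant A))"
    using fps_conv_radius_kneading_determinant[OF hol] by (auto simp: eball_def)
  have holo: "?f holomorphic_on eball 0 \<rho>"
    by (intro holomorphic_on_eval_fps sub)
  have f0: "?f 0 = 1"
    by (simp add: eval_fps_at_0 kneading_determinant_nth_0)
  have "cball 0 1 \<subseteq> eball (0::complex) \<rho>"
    using \<open>1 < \<rho>\<close> by (cases \<rho>) (auto simp: one_ereal_def)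
  have conn: "connected (eball (0::complex) \<rho>)" by (rule connected_eball)
  have fin: "finite {z \<in> cball 0 1. ?f z = 0}"
  proof (cases "?f constant_on eball 0 \<rho>")
    case True
    then obtain c where c: "\<And>z. z \<in> eball 0 \<rho> \<Longrightarrow> ?f z = c"
      by (auto simp: constant_on_def)
    have "c = 1" using c[of 0] f0 \<rho>0 by (simp add: zero_ereal_def)
    hence "{z \<in> cball 0 1. ?f z = 0} = {}"
      using c \<open>cball 0 1 \<subseteq> _\<close> by fastforce
    thus ?thesis by (simp only: finite.emptyI)
  next
    case False
    thus ?thesis
      using holomorphic_compact_finite_zeros[OF holo open_eball conn compact_cball]
        \<open>cball 0 1 \<subseteq> _\<close> by blast
  qed
  have "{\<mu>. \<exists>k. dominant_eigenvalue A \<rho> \<mu> k} \<subseteq> inverse ` {z \<in> cball 0 1. ?f z = 0}"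
  proof safe
    fix \<mu> k assume d: "dominant_eigenvalue A \<rho> \<mu> k"
    hence "inverse \<rho> < ereal (norm \<mu>)" "1 \<le> norm \<mu>"
      by (auto simp: dominant_eigenvalue_def generalized_eigenvalue_def)
    moreover from this(1) d have "?f (inverse \<mu>) = 0"
      using generalized_eigenvalue_iff_zero[OF \<rho>0 hol] by (auto simp: dominant_eigenvalue_def)
    ultimately show "\<mu> \<in> inverse ` {z \<in> cball 0 1. ?f z = 0}"
      by (intro image_eqI[of _ _ "inverse \<mu>"]) (auto simp: norm_inverse inverse_le_1_iff)
  qed
  thus ?thesis using fin finite_surj by blast
qed

end

theory Submission
  imports Defs
begin

text \<open>
  The generating functions of the coordinates of \<open>v\<close> solve a linear system with matrix
  \<open>I - zK\<close> whose right-hand side, built from the initial condition, converges on the same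
  disk as \<open>K\<close>. By Cramer's rule \<open>\<Delta>\<close> times each of these generating functions
  has radius of convergence greater than 1. Splitting off the zeros of \<open>\<Delta>\<close> in the closed
  unit disk, \<open>\<Delta> = (\<Prod>i. (1 - \<lambda>\<^sub>i z) ^ mul i) * G\<close> with \<open>1 / G\<close> converging beyond that
  disk, a partial fraction expansion leaves a remainder with radius of convergence greater
  than 1, so its coefficients tend to 0; the coefficients of \<open>1 / (1 - \<lambda> z) ^ j\<close> are
  \<open>(n + j - 1)! / ((j - 1)! n!) \<lambda> ^ n\<close>.

  For uniqueness, the power series with coefficients tending to 0 are closed under
  multiplication by \<open>1 - \<lambda> z\<close>. Multiplying a combination of polar parts by suitable such
  factors isolates its top coefficient at one pole, leaving a nonzero multiple of
  \<open>\<lambda> ^ n\<close> with \<open>\<bar>\<lambda>\<bar> \<ge> 1\<close>.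
\<close>

subsection \<open>Partial fractions\<close>

text \<open>Normalised by constant term 1 rather than monic, so that it is invertible as a power
  series. For \<open>c \<noteq> 0\<close> its only zero is the reciprocal of \<open>c\<close>,
  matching eigenvalues as reciprocals of zeros of the kneading determinant.\<close>

definition lin :: "complex \<Rightarrow> complex fps" where
  "lin c = 1 - fps_const c * fps_X"

lemma lin_eq_poly: "lin c = fps_of_poly [:1, -c:]"
  by (simp add: lin_def fps_of_poly_pCons fps_const_neg[symmetric] mult.commute del: fps_const_neg)

lemma lin_nth_0 [simp]: "fps_nth (lin c) 0 = 1"
  by (simp add: lin_def)

lemma lin_nonzero [simp]: "lin c \<noteq> 0"
  by (metis lin_nth_0 fps_zero_nth zero_neq_one)

lemma eval_fps_lin [simp]: "eval_fps (lin c) z = 1 - c * z"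
  by (simp add: lin_eq_poly algebra_simps)

lemma fps_conv_radius_lin [simp]: "fps_conv_radius (lin c) = \<infinity>"
  by (simp add: lin_eq_poly)

lemma prod_lin_eq_poly:
  "(\<Prod>i\<in>I. lin (e i) ^ k i) = fps_of_poly (\<Prod>i\<in>I. [:1, - e i:] ^ k i)"
  by (simp add: lin_eq_poly fps_of_poly_prod fps_of_poly_power)

lemma fps_conv_radius_prod_lin [simp]: "fps_conv_radius (\<Prod>i\<in>I. lin (e i) ^ k i) = \<infinity>"
  by (simp only: prod_lin_eq_poly fps_conv_radius_fps_of_poly)

lemma eval_fps_prod_lin:
  "eval_fps (\<Prod>i\<in>I. lin (e i) ^ k i) z = (\<Prod>i\<in>I. (1 - e i * z) ^ k i)"
  by (simp add: prod_lin_eq_poly poly_prod algebra_simps)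

lemma eval_fps_prod_lin_inverse_nonzero:
  assumes "finite I" "c \<noteq> 0" "\<And>l. l \<in> I \<Longrightarrow> e l \<noteq> c"
  shows "eval_fps (\<Prod>l\<in>I. lin (e l) ^ k l) (inverse c) \<noteq> 0"
  using assms by (auto simp: eval_fps_prod_lin field_simps)

text \<open>The negative binomial series. It links poles of a generating function to the terms
  attached to \<open>c (i, j)\<close> in the theorem.\<close>

lemma nth_inverse_lin_power:
  assumes "j > 0"
  shows "fps_nth (inverse (lin c ^ j)) n = fact (n + j - 1) / (fact (j - 1) * fact n) * c ^ n"
proof -
  have "of_nat ((j + n - 1) choose n) = (fact (n + j - 1) / (fact n * fact (j - 1)) :: complex)"
    using assms binomial_fact[of n "j + n - 1", where 'a = complex] by (simp add: add.commute)
  thus ?thesis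
    unfolding lin_def one_minus_const_fps_X_neg_power'[OF assms] by simp
qed

lemma lin_power_mult_inverse_power:
  assumes "j \<le> k"
  shows "lin c ^ k * inverse (lin c ^ j) = lin c ^ (k - j)"
proof -
  have "lin c ^ k = lin c ^ (k - j) * lin c ^ j"
    using assms by (simp flip: power_add)
  moreover have "fps_nth (lin c ^ j) 0 \<noteq> 0"
    by (simp add: fps_nth_power_0)
  ultimately show ?thesis
    by (simp add: mult.assoc inverse_mult_eq_1')
qed

text \<open>Division with remainder by \<open>lin c\<close> among convergent series. With
  \<open>a\<close> the reciprocal of \<open>c\<close>, the difference quotient of \<open>f\<close>
  at \<open>a\<close> has a removable singularity, so it is holomorphic on the whole disk of
  \<open>f\<close> and its Taylor series at 0 converges there.\<close>

lemma fps_deflate: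
  fixes f :: "complex fps"
  assumes "c \<noteq> 0" "ereal (norm (inverse c)) < fps_conv_radius f"
  obtains g where "fps_conv_radius f \<le> fps_conv_radius g"
    "f = fps_const (eval_fps f (inverse c)) + lin c * g"
proof -
  define a where "a = inverse c"
  define R where "R = fps_conv_radius f"
  have a: "a \<noteq> 0" "c = inverse a" "ereal (norm a) < R"
    using assms by (auto simp: a_def R_def)
  define F where "F = (\<lambda>z. if z = a then deriv (eval_fps f) a
                            else (eval_fps f z - eval_fps f a) / (z - a))"
  have F: "F holomorphic_on eball 0 R"
    unfolding F_def by (intro pole_lemma_open holomorphic_on_eval_fps) (auto simp: R_def)
  \<comment> \<open>The factor \<open>-a\<close> compensates for the normalisation of
    \<open>lin c\<close>: \<open>1 - c * z = - c * (z - a)\<close> and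
    \<open>c * a = 1\<close>.\<close>
  define g where "g = fps_const (-a) * fps_expansion F 0"
  have rexp: "R \<le> fps_conv_radius (fps_expansion F 0)"
    by (rule conv_radius_fps_expansion[OF F])
  hence rg: "R \<le> fps_conv_radius g"
    unfolding g_def by (intro fps_conv_radius_mult_ge) auto
  have "0 \<le> ereal (norm a)" by simp
  hence R0: "R > 0" using a(3) by (rule le_less_trans)
  have rh: "R \<le> fps_conv_radius (fps_const (eval_fps f a) + lin c * g)"
    by (intro fps_conv_radius_add_ge fps_conv_radius_mult_ge rg) auto
  have "f = fps_const (eval_fps f a) + lin c * g"
  proof (rule eval_fps_eqD)
    show "fps_conv_radius f > 0" "fps_conv_radius (fps_const (eval_fps f a) + lin c * g) > 0"
      using R0 rh by (auto simp: R_def)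
    have "eventually (\<lambda>z. z \<in> eball 0 R) (nhds 0)"
      using R0 by (intro eventually_nhds_in_open) (auto simp: zero_ereal_def)
    thus "eventually (\<lambda>z. eval_fps f z = eval_fps (fps_const (eval_fps f a) + lin c * g) z) (nhds 0)"
    proof eventually_elim
      case (elim z)
      hence z: "ereal (norm z) < R" by simp
      have 1: "eval_fps (fps_expansion F 0) z = F z"
        using eval_fps_expansion'[OF F z] by simp
      have 2: "ereal (norm z) < fps_conv_radius (lin c * g)"
        using z rg by (intro less_le_trans[OF _ fps_conv_radius_mult_ge[of R]]) auto
      have "eval_fps (fps_const (eval_fps f a) + lin c * g) z = eval_fps f a + (1 - c * z) * (-a * F z)"
        using z rg rexp 1 2 unfolding g_def
        by (simp add: eval_fps_add eval_fps_mult less_le_trans[OF z])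
      also have "(1 - c * z) * (-a * F z) = (z - a) * F z"
        using a by (simp add: field_simps)
      also have "eval_fps f a + (z - a) * F z = eval_fps f z"
        by (auto simp: F_def)
      finally show ?case ..
    qed
  qed
  thus ?thesis using that rg by (simp add: a_def R_def)
qed

lemma conv_radius_gt_mult:
  fixes f g :: "complex fps"
  shows "R < fps_conv_radius f \<Longrightarrow> R < fps_conv_radius g \<Longrightarrow> R < fps_conv_radius (f * g)"
  using fps_conv_radius_mult[of f g] by (meson less_le_trans min_less_iff_conj)

lemma conv_radius_gt_diff:
  fixes f g :: "complex fps"
  shows "R < fps_conv_radius f \<Longrightarrow> R < fps_conv_radius g \<Longrightarrow> R < fps_conv_radius (f - g)"
  using fps_conv_radius_diff[of f g] by (meson less_le_trans min_less_iff_conj)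

lemma inverse_in_disk:
  fixes c :: complex and f :: "complex fps"
  assumes "1 \<le> norm c" "1 < fps_conv_radius f"
  shows "ereal (norm (inverse c)) < fps_conv_radius f"
proof -
  have "norm (inverse c) \<le> 1"
    using assms(1) by (cases "c = 0") (auto simp: norm_inverse inverse_le_1_iff)
  thus ?thesis using assms(2) by (metis ereal_less_eq(3) one_ereal_def le_less_trans)
qed

text \<open>\<open>Q\<close> is the rest of the denominator of \<open>V\<close>, so the last
  hypothesis allows a pole of order at most \<open>k\<close> at the reciprocal of \<open>c\<close>.
  Subtracting a suitable multiple of the top polar term lowers this order by one; poles due to
  \<open>Q\<close> are left to \<open>V'\<close>.\<close>

lemma partial_fraction_single_pole:
  assumes "1 \<le> norm c" "1 < fps_conv_radius Q" "eval_fps Q (inverse c) \<noteq> 0"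
    and "1 < fps_conv_radius (lin c ^ k * Q * V)"
  obtains d V' where "V = (\<Sum>j = 1..k. fps_const (d j) * inverse (lin c ^ j)) + V'"
    "1 < fps_conv_radius (Q * V')"
proof -
  have c: "c \<noteq> 0" using assms(1) by auto
  note in_disk = inverse_in_disk[OF assms(1)]
  have "\<exists>d V'. V = (\<Sum>j = 1..k. fps_const (d j) * inverse (lin c ^ j)) + V' \<and> 1 < fps_conv_radius (Q * V')"
    using assms(4)
  proof (induction k arbitrary: V)
    case 0
    thus ?case by (intro exI[of _ undefined] exI[of _ V]) simp
  next
    case (Suc k)
    let ?H = "lin c ^ Suc k * Q * V"
    \<comment> \<open>chosen such that subtracting \<open>x / (1 - c z) ^ Suc k\<close> from \<open>V\<close> makes the numerator vanish at \<open>1 / c\<close>\<close>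
    define x where "x = eval_fps ?H (inverse c) / eval_fps Q (inverse c)"
    define V1 where "V1 = V - fps_const x * inverse (lin c ^ Suc k)"
    let ?H1 = "?H - fps_const x * Q"
    have r1: "1 < fps_conv_radius (fps_const x * Q)"
      by (intro conv_radius_gt_mult assms) simp
    have H1: "lin c ^ Suc k * Q * V1 = ?H1"
    proof -
      have "lin c ^ Suc k * Q * V1 = ?H - fps_const x * Q * (lin c ^ Suc k * inverse (lin c ^ Suc k))"
        unfolding V1_def by (simp only: algebra_simps)
      thus ?thesis by (simp only: lin_power_mult_inverse_power) simp
    qed
    have r: "1 < fps_conv_radius ?H1"
      by (intro conv_radius_gt_diff Suc.prems r1)
    have "eval_fps ?H1 (inverse c) = eval_fps ?H (inverse c) - x * eval_fps Q (inverse c)"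
      by (subst eval_fps_diff[OF in_disk[OF Suc.prems] in_disk[OF r1]],
          subst eval_fps_mult[OF _ in_disk[OF assms(2)]]) simp_all
    hence "eval_fps ?H1 (inverse c) = 0"
      using assms(3) by (simp only: x_def) simp
    then obtain g where g: "fps_conv_radius ?H1 \<le> fps_conv_radius g" "?H1 = lin c * g"
      using fps_deflate[OF c in_disk[OF r]] by auto
    have "lin c * (lin c ^ k * Q * V1) = lin c * g"
      unfolding g(2)[symmetric] H1[symmetric] by (simp add: mult_ac)
    hence "lin c ^ k * Q * V1 = g" by (subst (asm) mult_cancel_left) simp
    hence "1 < fps_conv_radius (lin c ^ k * Q * V1)"
      using r g(1) by auto
    from Suc.IH[OF this] obtain d V' where
      d: "V1 = (\<Sum>j = 1..k. fps_const (d j) * inverse (lin c ^ j)) + V'" "1 < fps_conv_radius (Q * V')"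
      by blast
    have "V = (\<Sum>j = 1..Suc k. fps_const ((d(Suc k := x)) j) * inverse (lin c ^ j)) + V'"
      using d(1) by (simp add: V1_def algebra_simps)
    thus ?case using d(2) by blast
  qed
  thus ?thesis using that by blast
qed

text \<open>One pole is removed at a time: the remaining product times \<open>G\<close> serves as
  \<open>Q\<close>, nonzero at the current pole because \<open>e\<close> is injective. At the end
  only \<open>G\<close> is still needed to clear the denominator of \<open>V'\<close>.\<close>

lemma partial_fractions:
  fixes e :: "'i \<Rightarrow> complex"
  assumes "finite I" "inj_on e I" "\<And>i. i \<in> I \<Longrightarrow> 1 \<le> norm (e i)"
    and "1 < fps_conv_radius G" "\<And>i. i \<in> I \<Longrightarrow> eval_fps G (inverse (e i)) \<noteq> 0"
    and "1 < fps_conv_radius ((\<Prod>i\<in>I. lin (e i) ^ k i) * G * V)"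
  shows "\<exists>d V'. V = (\<Sum>i\<in>I. \<Sum>j = 1..k i. fps_const (d i j) * inverse (lin (e i) ^ j)) + V' \<and>
    1 < fps_conv_radius (G * V')"
  using assms
proof (induction I arbitrary: V rule: finite_induct)
  case empty
  thus ?case by (intro exI[of _ undefined] exI[of _ V]) simp
next
  case (insert i I)
  let ?P = "\<Prod>i\<in>I. lin (e i) ^ k i"
  have ei: "1 \<le> norm (e i)" "e i \<noteq> 0" using insert.prems(2)[of i] by auto
  note in_disk = inverse_in_disk[OF ei(1) insert.prems(3)]
  have "eval_fps ?P (inverse (e i)) \<noteq> 0"
    using insert.hyps insert.prems(1) ei by (intro eval_fps_prod_lin_inverse_nonzero) (auto simp: image_iff)
  hence nz: "eval_fps (?P * G) (inverse (e i)) \<noteq> 0"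
    using in_disk insert.prems(4)[of i] by (simp add: eval_fps_mult)
  have r: "1 < fps_conv_radius (?P * G)"
    by (intro conv_radius_gt_mult insert.prems) simp
  have "1 < fps_conv_radius (lin (e i) ^ k i * (?P * G) * V)"
    using insert.prems(5) insert.hyps by (simp add: mult_ac)
  from partial_fraction_single_pole[OF ei(1) r nz this] obtain d V1 where
    d: "V = (\<Sum>j = 1..k i. fps_const (d j) * inverse (lin (e i) ^ j)) + V1"
       "1 < fps_conv_radius (?P * G * V1)" by blast
  obtain d' V' where
    d': "V1 = (\<Sum>i\<in>I. \<Sum>j = 1..k i. fps_const (d' i j) * inverse (lin (e i) ^ j)) + V'"
        "1 < fps_conv_radius (G * V')"
    using insert.IH[OF _ _ _ _ d(2)] insert.prems by auto
  have "V = (\<Sum>l\<in>insert i I. \<Sum>j = 1..k l. fps_const ((d'(i := d)) l j) * inverse (lin (e l) ^ j)) + V'"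
  proof -
    have "(\<Sum>l\<in>I. \<Sum>j = 1..k l. fps_const ((d'(i := d)) l j) * inverse (lin (e l) ^ j)) =
          (\<Sum>l\<in>I. \<Sum>j = 1..k l. fps_const (d' l j) * inverse (lin (e l) ^ j))"
      using insert.hyps by (intro sum.cong) auto
    thus ?thesis using insert.hyps d(1) d'(1) by (simp add: add.assoc)
  qed
  thus ?case using d'(2) by blast
qed

subsection \<open>Power series with coefficients tending to zero\<close>

text \<open>Coefficient \<open>n + 1\<close> of the product is a fixed linear combination of two
  neighbouring coefficients of \<open>f\<close>, whatever the size of \<open>c\<close>.\<close>

lemma tendsto_nth_lin_mult:
  assumes "fps_nth f \<longlonglongrightarrow> 0"
  shows "fps_nth (lin c * f) \<longlonglongrightarrow> 0"
proof -
  have "(\<lambda>n. fps_nth f (Suc n) - c * fps_nth f n) \<longlonglongrightarrow> 0 - c * 0"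
    by (intro tendsto_intros LIMSEQ_Suc assms)
  also have "(\<lambda>n. fps_nth f (Suc n) - c * fps_nth f n) = (\<lambda>n. fps_nth (lin c * f) (Suc n))"
    by (simp add: lin_def algebra_simps)
  finally show ?thesis
    by (simp add: LIMSEQ_imp_Suc)
qed

lemma tendsto_nth_lin_power_mult:
  "fps_nth f \<longlonglongrightarrow> 0 \<Longrightarrow> fps_nth (lin c ^ k * f) \<longlonglongrightarrow> 0"
  by (induction k) (auto simp: mult.assoc intro: tendsto_nth_lin_mult)

lemma tendsto_nth_prod_lin_mult:
  "fps_nth f \<longlonglongrightarrow> 0 \<Longrightarrow> fps_nth ((\<Prod>i\<in>I. lin (e i) ^ k i) * f) \<longlonglongrightarrow> 0"
  by (induction I rule: infinite_finite_induct)
     (auto simp: mult.assoc intro: tendsto_nth_lin_power_mult)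

lemma tendsto_nth_const_mult:
  fixes f :: "complex fps"
  assumes "fps_nth f \<longlonglongrightarrow> 0"
  shows "fps_nth (fps_const c * f) \<longlonglongrightarrow> 0"
proof -
  have "fps_nth (fps_const c * f) = (\<lambda>n. c * fps_nth f n)" by auto
  thus ?thesis using tendsto_mult_right_zero[OF assms] by simp
qed

lemma tendsto_nth_diff:
  fixes f g :: "complex fps"
  assumes "fps_nth f \<longlonglongrightarrow> 0" "fps_nth g \<longlonglongrightarrow> 0"
  shows "fps_nth (f - g) \<longlonglongrightarrow> 0"
proof -
  have "fps_nth (f - g) = (\<lambda>n. fps_nth f n - fps_nth g n)" by auto
  thus ?thesis using tendsto_diff[OF assms] by simp
qed

lemma tendsto_nth_sum:
  fixes f :: "'i \<Rightarrow> complex fps"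
  assumes "\<And>i. i \<in> I \<Longrightarrow> fps_nth (f i) \<longlonglongrightarrow> 0"
  shows "fps_nth (sum f I) \<longlonglongrightarrow> 0"
proof -
  have "fps_nth (sum f I) = (\<lambda>n. \<Sum>i\<in>I. fps_nth (f i) n)"
    by (auto simp: fps_sum_nth)
  moreover have "(\<lambda>n. \<Sum>i\<in>I. fps_nth (f i) n) \<longlonglongrightarrow> 0"
    using assms by (intro tendsto_null_sum) auto
  ultimately show ?thesis by simp
qed

text \<open>Such a series converges at \<open>z = 1\<close>, where its terms are its
  coefficients.\<close>

lemma tendsto_nth_of_conv_radius:
  fixes f :: "complex fps"
  assumes "1 < fps_conv_radius f"
  shows "fps_nth f \<longlonglongrightarrow> 0"
  using summable_LIMSEQ_zero[OF summable_fps[of 1 f]] assms by (simp add: one_ereal_def)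

section \<open>Uniqueness of polar parts\<close>

text \<open>Isolating the nonzero coefficient of highest order \<open>J\<close> at the pole of
  \<open>i\<close> would make a nonzero multiple of \<open>e i ^ n\<close> tend to 0, which
  \<open>1 \<le> norm (e i)\<close> forbids.\<close>

lemma polar_parts_unique:
  fixes e :: "'i \<Rightarrow> complex"
  assumes "finite I" "inj_on e I" "\<And>i. i \<in> I \<Longrightarrow> 1 \<le> norm (e i)"
    and null: "fps_nth (\<Sum>l\<in>I. \<Sum>j = 1..k l. fps_const (d l j) * inverse (lin (e l) ^ j)) \<longlonglongrightarrow> 0"
    and "i \<in> I" "j \<in> {1..k i}"
  shows "d i j = 0"
proof (rule ccontr)
  assume nz: "d i j \<noteq> 0"
  define J where "J = Max {j \<in> {1..k i}. d i j \<noteq> 0}"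
  have "J \<in> {j \<in> {1..k i}. d i j \<noteq> 0}"
    unfolding J_def using nz assms(6) by (intro Max_in) auto
  hence J: "J \<in> {1..k i}" "d i J \<noteq> 0" by auto
  have above: "d i j = 0" if "j \<in> {1..k i}" "j > J" for j
    using that Max_ge[of "{j \<in> {1..k i}. d i j \<noteq> 0}" j] unfolding J_def by fastforce
  have ei: "1 \<le> norm (e i)" "e i \<noteq> 0" using assms(3)[OF assms(5)] by auto
  define Q where "Q = (\<Prod>l\<in>I-{i}. lin (e l) ^ k l)"
  \<comment> \<open>\<open>P\<close> turns every term of the sum except the \<open>(i, J)\<close> one into a polynomial\<close>
  define P where "P = Q * lin (e i) ^ (J - 1)"
  define t where "t = (\<lambda>l j. fps_const (d l j) * inverse (lin (e l) ^ j))"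
  \<comment> \<open>The constant series 1 seeds the closure rules: a polynomial in the
    \<open>lin\<close> factors is treated as a multiple of it, hence the trailing \<open>* 1\<close>
    below.\<close>
  have null1: "fps_nth (1 :: complex fps) \<longlonglongrightarrow> 0"
    by (rule tendsto_nth_of_conv_radius) simp
  have Qnull: "fps_nth (Q * f) \<longlonglongrightarrow> 0" if "fps_nth f \<longlonglongrightarrow> 0" for f
    unfolding Q_def by (rule tendsto_nth_prod_lin_mult[OF that])
  have Pnull: "fps_nth (P * f) \<longlonglongrightarrow> 0" if "fps_nth f \<longlonglongrightarrow> 0" for f
    unfolding P_def mult.assoc by (intro Qnull tendsto_nth_lin_power_mult that)
  \<comment> \<open>At another pole, \<open>Q\<close> contains \<open>lin (e l)\<close> to the full
    power \<open>k l\<close>, enough to cancel order \<open>j\<close>.\<close>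
  have others: "fps_nth (P * t l j) \<longlonglongrightarrow> 0" if "l \<in> I - {i}" "j \<in> {1..k l}" for l j
  proof -
    have "P = lin (e l) ^ k l * ((\<Prod>l\<in>I-{i}-{l}. lin (e l) ^ k l) * lin (e i) ^ (J - 1))"
      unfolding P_def Q_def using that assms(1) by (subst prod.remove[of _ l]) (auto simp: mult.assoc)
    hence "P * t l j = fps_const (d l j) * ((lin (e l) ^ k l * inverse (lin (e l) ^ j)) *
        ((\<Prod>l\<in>I-{i}-{l}. lin (e l) ^ k l) * (lin (e i) ^ (J - 1) * 1)))"
      by (simp add: t_def mult_ac)
    also have "lin (e l) ^ k l * inverse (lin (e l) ^ j) = lin (e l) ^ (k l - j)"
      using that by (intro lin_power_mult_inverse_power) auto
    finally have eq: "P * t l j = fps_const (d l j) * (lin (e l) ^ (k l - j) *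
        ((\<Prod>l\<in>I-{i}-{l}. lin (e l) ^ k l) * (lin (e i) ^ (J - 1) * 1)))" .
    show ?thesis unfolding eq
      by (intro tendsto_nth_const_mult tendsto_nth_lin_power_mult tendsto_nth_prod_lin_mult null1)
  qed
  \<comment> \<open>Coefficients above \<open>J\<close> vanish by maximality; orders below
    \<open>J\<close> are cancelled by the power \<open>J - 1\<close> in \<open>P\<close>.\<close>
  have lower: "fps_nth (P * t i j) \<longlonglongrightarrow> 0" if "j \<in> {1..k i} - {J}" for j
  proof (cases "j > J")
    case True
    hence "t i j = 0" using above[of j] that by (simp add: t_def)
    thus ?thesis using tendsto_nth_const_mult[OF null1, of 0] by simp
  next
    case False
    have "P * t i j = fps_const (d i j) * (Q * ((lin (e i) ^ (J - 1) * inverse (lin (e i) ^ j)) * 1))"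
      by (simp add: t_def P_def mult_ac)
    also have "lin (e i) ^ (J - 1) * inverse (lin (e i) ^ j) = lin (e i) ^ (J - 1 - j)"
      using that False by (intro lin_power_mult_inverse_power) auto
    finally have eq: "P * t i j = fps_const (d i j) * (Q * (lin (e i) ^ (J - 1 - j) * 1))" .
    show ?thesis unfolding eq
      by (intro tendsto_nth_const_mult tendsto_nth_lin_power_mult Qnull null1)
  qed
  have "(\<Sum>l\<in>I. \<Sum>j = 1..k l. t l j) =
      (\<Sum>l\<in>I-{i}. \<Sum>j = 1..k l. t l j) + (\<Sum>j\<in>{1..k i}-{J}. t i j) + t i J"
    using sum.remove[OF assms(1,5), of "\<lambda>l. \<Sum>j = 1..k l. t l j"]
      sum.remove[OF finite_atLeastAtMost J(1), of "t i"] by (simp add: algebra_simps)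
  hence "P * t i J = P * (\<Sum>l\<in>I. \<Sum>j = 1..k l. t l j) -
      (\<Sum>l\<in>I-{i}. \<Sum>j = 1..k l. P * t l j) - (\<Sum>j\<in>{1..k i}-{J}. P * t i j)"
    by (simp add: algebra_simps sum_distrib_left)
  also have "fps_nth \<dots> \<longlonglongrightarrow> 0"
  proof (intro tendsto_nth_diff)
    show "fps_nth (P * (\<Sum>l\<in>I. \<Sum>j = 1..k l. t l j)) \<longlonglongrightarrow> 0"
      unfolding t_def by (intro Pnull null)
    show "fps_nth (\<Sum>l\<in>I-{i}. \<Sum>j = 1..k l. P * t l j) \<longlonglongrightarrow> 0"
      by (intro tendsto_nth_sum others)
    show "fps_nth (\<Sum>j\<in>{1..k i}-{J}. P * t i j) \<longlonglongrightarrow> 0"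
      by (intro tendsto_nth_sum lower)
  qed
  finally have top: "fps_nth (P * t i J) \<longlonglongrightarrow> 0" .
  \<comment> \<open>\<open>P * t i J\<close> reduces to a multiple of \<open>Q\<close> over a single
    \<open>lin (e i)\<close>. Dividing \<open>Q\<close> by that factor, with remainder
    \<open>q \<noteq> 0\<close>, splits it into a simple pole and a series whose coefficients tend
    to 0.\<close>
  obtain g where g: "fps_conv_radius Q \<le> fps_conv_radius g"
      "Q = fps_const (eval_fps Q (inverse (e i))) + lin (e i) * g"
    using fps_deflate[OF ei(2), of Q] by (auto simp: Q_def)
  define q where "q = eval_fps Q (inverse (e i))"
  have q: "q \<noteq> 0"
    unfolding q_def Q_def using assms(1,2,5) ei
    by (intro eval_fps_prod_lin_inverse_nonzero) (auto dest: inj_onD)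
  have "1 < fps_conv_radius g"
    using g(1) by (simp add: Q_def)
  hence gnull: "fps_nth g \<longlonglongrightarrow> 0" by (rule tendsto_nth_of_conv_radius)
  have inv: "lin (e i) * inverse (lin (e i)) = 1"
    using lin_power_mult_inverse_power[of 1 1 "e i"] by simp
  have "lin (e i) ^ (J - 1) * inverse (lin (e i) ^ J) = inverse (lin (e i))"
  proof -
    have "lin (e i) * (lin (e i) ^ (J - 1) * inverse (lin (e i) ^ J)) =
        lin (e i) ^ J * inverse (lin (e i) ^ J)"
      using J(1) by (cases J) (auto simp: mult_ac)
    also have "\<dots> = lin (e i) * inverse (lin (e i))"
      by (simp add: lin_power_mult_inverse_power inv)
    finally show ?thesis by simp
  qed
  hence "P * t i J = fps_const (d i J) * (Q * inverse (lin (e i)))"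
    by (simp add: P_def t_def mult_ac)
  also have "Q * inverse (lin (e i)) = (fps_const q + lin (e i) * g) * inverse (lin (e i))"
    by (subst g(2)) (simp only: q_def)
  also have "\<dots> = fps_const q * inverse (lin (e i)) + g * (lin (e i) * inverse (lin (e i)))"
    by (simp only: ring_distribs mult_ac)
  also have "\<dots> = fps_const q * inverse (lin (e i)) + g"
    unfolding inv by simp
  finally have "P * t i J = fps_const (d i J * q) * inverse (lin (e i)) + fps_const (d i J) * g"
    by (simp add: algebra_simps flip: fps_const_mult)
  hence "fps_const (d i J * q) * inverse (lin (e i)) = P * t i J - fps_const (d i J) * g"
    by simp
  also have "fps_nth \<dots> \<longlonglongrightarrow> 0"
    by (intro tendsto_nth_diff tendsto_nth_const_mult top gnull)
  finally have "(\<lambda>n. d i J * q * e i ^ n) \<longlonglongrightarrow> 0"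
    using nth_inverse_lin_power[of 1 "e i"] by (simp add: fps_mult_left_const_nth)
  hence "(\<lambda>n. norm (d i J * q * e i ^ n)) \<longlonglongrightarrow> 0"
    by (rule tendsto_norm_zero)
  moreover have "norm (d i J * q) \<le> norm (d i J * q * e i ^ n)" for n
    using mult_left_mono[OF one_le_power[OF ei(1)], of "norm (d i J * q)" n]
    by (simp add: norm_mult norm_power)
  ultimately have "norm (d i J * q) \<le> 0"
    by (intro LIMSEQ_le_const) auto
  thus False using J(2) q by simp
qed

subsection \<open>Splitting off zeros\<close>

lemma analytic_at_eval_fps:
  fixes f :: "complex fps"
  assumes "ereal (norm a) < fps_conv_radius f"
  shows "eval_fps f analytic_on {a}"
  using assms by (intro analytic_on_eval_fps[THEN analytic_on_subset, of _ "{a}"]) auto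

lemma eventually_in_disk:
  fixes a :: complex
  assumes "ereal (norm a) < R"
  shows "eventually (\<lambda>z. ereal (norm z) < R) (at a)"
proof -
  have "eventually (\<lambda>z. z \<in> eball 0 R) (at a)"
    using assms by (intro eventually_at_in_open') auto
  thus ?thesis by simp
qed

text \<open>Evaluation is known to be multiplicative only inside both disks, so the functions are
  compared near \<open>a\<close>. As the product is not locally zero, neither factor is, and then
  orders add.\<close>

lemma zorder_eval_fps_mult:
  fixes f g :: "complex fps"
  assumes "ereal (norm a) < fps_conv_radius f" "ereal (norm a) < fps_conv_radius g"
    and "eventually (\<lambda>z. eval_fps (f * g) z \<noteq> 0) (at a)"
  shows "zorder (eval_fps (f * g)) a = zorder (eval_fps f) a + zorder (eval_fps g) a"
    and "eventually (\<lambda>z. eval_fps g z \<noteq> 0) (at a)"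
proof -
  have eq: "eventually (\<lambda>z. eval_fps (f * g) z = eval_fps f z * eval_fps g z) (at a)"
    using eventually_in_disk[OF assms(1)] eventually_in_disk[OF assms(2)]
    by eventually_elim (simp add: eval_fps_mult)
  have nz: "eventually (\<lambda>z. eval_fps f z * eval_fps g z \<noteq> 0) (at a)"
    using eq assms(3) by eventually_elim simp
  thus "eventually (\<lambda>z. eval_fps g z \<noteq> 0) (at a)"
    by eventually_elim simp
  have "zorder (eval_fps (f * g)) a = zorder (\<lambda>z. eval_fps f z * eval_fps g z) a"
    using eq by (intro zorder_cong) auto
  also have "\<dots> = zorder (eval_fps f) a + zorder (eval_fps g) a"
    using assms nz by (intro zorder_times_analytic analytic_at_eval_fps)
  finally show "zorder (eval_fps (f * g)) a = zorder (eval_fps f) a + zorder (eval_fps g) a" .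
qed

lemma zorder_lin:
  assumes "c \<noteq> 0"
  shows "zorder (eval_fps (lin c)) (inverse c) = 1"
  by (rule zorder_eqI[of UNIV _ "\<lambda>_. - c"]) (use assms in \<open>auto simp: field_simps\<close>)

text \<open>Repeated division by \<open>lin c\<close>, which has a simple zero: each quotient keeps
  the radius and has order one less, until order 0 means a nonzero value.\<close>

lemma fps_factor_zero:
  fixes f :: "complex fps"
  assumes "c \<noteq> 0" "ereal (norm (inverse c)) < fps_conv_radius f"
    and "eventually (\<lambda>z. eval_fps f z \<noteq> 0) (at (inverse c))"
    and "zorder (eval_fps f) (inverse c) = int k"
  shows "\<exists>g. fps_conv_radius f \<le> fps_conv_radius g \<and> f = lin c ^ k * g \<and> eval_fps g (inverse c) \<noteq> 0"
  using assms(2-)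
proof (induction k arbitrary: f)
  case 0
  have "eval_fps f (inverse c) \<noteq> 0"
  proof
    assume "eval_fps f (inverse c) = 0"
    hence "isolated_zero (eval_fps f) (inverse c)"
      using 0 by (simp add: isolated_zero_analytic_iff analytic_at_eval_fps)
    hence "zorder (eval_fps f) (inverse c) > 0"
      using 0 by (intro zorder_isolated_zero_pos analytic_at_eval_fps)
    thus False using 0 by simp
  qed
  thus ?case by (intro exI[of _ f]) auto
next
  case (Suc k)
  have z: "eval_fps f (inverse c) = 0"
  proof (rule ccontr)
    assume "eval_fps f (inverse c) \<noteq> 0"
    hence "zorder (eval_fps f) (inverse c) = 0"
      using Suc.prems by (intro zorder_eq_0I analytic_at_eval_fps)
    thus False using Suc.prems by simp
  qed
  obtain g where g: "fps_conv_radius f \<le> fps_conv_radius g" "f = lin c * g"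
    using fps_deflate[OF assms(1) Suc.prems(1)] z by auto
  have dg: "ereal (norm (inverse c)) < fps_conv_radius g"
    using Suc.prems(1) g(1) by (rule less_le_trans)
  note m = zorder_eval_fps_mult[of "inverse c" "lin c" g, folded g(2)]
  have "zorder (eval_fps g) (inverse c) = int k"
    using m(1) dg Suc.prems zorder_lin[OF assms(1)] by simp
  moreover have "eventually (\<lambda>z. eval_fps g z \<noteq> 0) (at (inverse c))"
    using m(2) dg Suc.prems by simp
  ultimately obtain h where h: "fps_conv_radius g \<le> fps_conv_radius h" "g = lin c ^ k * h"
      "eval_fps h (inverse c) \<noteq> 0"
    using Suc.IH[of g] dg by auto
  have "f = lin c ^ Suc k * h" using g(2) h(2) by (simp add: mult_ac)
  thus ?case using h(3) order_trans[OF g(1) h(1)] by blast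
qed

text \<open>The factors already split off do not vanish at the next point because \<open>e\<close>
  is injective, so the whole order there passes to the cofactor \<open>G\<close>.\<close>

lemma fps_factor_zeros:
  fixes f :: "complex fps" and e :: "'i \<Rightarrow> complex"
  assumes "finite I" "inj_on e I" "1 < fps_conv_radius f"
    and "\<And>i. i \<in> I \<Longrightarrow> 1 \<le> norm (e i)"
    and "\<And>i. i \<in> I \<Longrightarrow> eventually (\<lambda>z. eval_fps f z \<noteq> 0) (at (inverse (e i)))"
    and "\<And>i. i \<in> I \<Longrightarrow> zorder (eval_fps f) (inverse (e i)) = int (k i)"
  shows "\<exists>G. fps_conv_radius f \<le> fps_conv_radius G \<and> f = (\<Prod>i\<in>I. lin (e i) ^ k i) * G \<and>
    (\<forall>i\<in>I. eval_fps G (inverse (e i)) \<noteq> 0)"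
  using assms
proof (induction I rule: finite_induct)
  case empty
  thus ?case by (intro exI[of _ f]) auto
next
  case (insert i I)
  let ?P = "\<Prod>i\<in>I. lin (e i) ^ k i"
  let ?a = "inverse (e i)"
  obtain G where G: "fps_conv_radius f \<le> fps_conv_radius G" "f = ?P * G"
      "\<And>i. i \<in> I \<Longrightarrow> eval_fps G (inverse (e i)) \<noteq> 0"
    using insert by auto
  have rG: "1 < fps_conv_radius G" using insert.prems(2) G(1) by (rule less_le_trans)
  have ei: "1 \<le> norm (e i)" "e i \<noteq> 0" using insert.prems(3)[of i] by auto
  have dG: "ereal (norm ?a) < fps_conv_radius G"
    by (rule inverse_in_disk[OF ei(1) rG])
  have "eval_fps ?P ?a \<noteq> 0"
    using insert.hyps insert.prems(1) ei by (intro eval_fps_prod_lin_inverse_nonzero) (auto simp: image_iff)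
  hence "zorder (eval_fps ?P) ?a = 0"
    by (intro zorder_eq_0I analytic_at_eval_fps) auto
  moreover note m = zorder_eval_fps_mult[of ?a ?P G, folded G(2)]
  ultimately have "zorder (eval_fps G) ?a = int (k i)"
    using insert.prems(4)[of i] insert.prems(5)[of i] dG by simp
  moreover have "eventually (\<lambda>z. eval_fps G z \<noteq> 0) (at ?a)"
    using m(2) dG insert.prems(4)[of i] by simp
  ultimately obtain H where H: "fps_conv_radius G \<le> fps_conv_radius H" "G = lin (e i) ^ k i * H"
      "eval_fps H ?a \<noteq> 0"
    using fps_factor_zero[OF ei(2) dG] by blast
  have rH: "1 < fps_conv_radius H" using rG H(1) by (rule less_le_trans)
  \<comment> \<open>Earlier points stay free of zeros, since a zero of \<open>H\<close> would be one
    of \<open>G\<close>.\<close>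
  have "eval_fps H (inverse (e l)) \<noteq> 0" if "l \<in> I" for l
  proof
    assume 0: "eval_fps H (inverse (e l)) = 0"
    have d: "ereal (norm (inverse (e l))) < fps_conv_radius H"
      using inverse_in_disk[OF _ rH] insert.prems(3)[of l] that by simp
    have "ereal (norm (inverse (e l))) < fps_conv_radius (lin (e i) ^ k i)"
      by (rule less_le_trans[OF _ fps_conv_radius_power]) simp
    hence "eval_fps G (inverse (e l)) = 0"
      unfolding H(2) using d 0 by (simp add: eval_fps_mult)
    thus False using G(3)[OF that] by simp
  qed
  moreover have "f = (\<Prod>i\<in>insert i I. lin (e i) ^ k i) * H"
    using G(2) H(2) insert.hyps by (simp add: mult_ac)
  ultimately show ?case using H G(1) by (intro exI[of _ H]) auto
qed

text \<open>The zeros of \<open>G\<close> in a closed disk of radius \<open>s > 1\<close> form a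
  compact set. If there are any, one of least modulus lies outside the closed unit disk, so
  \<open>G\<close> has no zeros on some disk of radius above 1 and its reciprocal converges
  there.\<close>

lemma fps_conv_radius_inverse_gt_1:
  fixes G :: "complex fps"
  assumes "1 < fps_conv_radius G" "\<And>z. norm z \<le> 1 \<Longrightarrow> eval_fps G z \<noteq> 0"
  shows "1 < fps_conv_radius (inverse G)"
proof -
  obtain s where s: "1 < s" "ereal s < fps_conv_radius G"
    using ereal_dense2[OF assms(1)] by (auto simp: one_ereal_def)
  define K where "K = {z \<in> cball 0 s. eval_fps G z = 0}"
  have "\<exists>r>1. \<forall>z. norm z < r \<longrightarrow> eval_fps G z \<noteq> 0"
  proof (cases "K = {}")
    case True
    thus ?thesis using s by (intro exI[of _ s]) (auto simp: K_def)
  next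
    case False
    have "continuous_on (cball 0 s) (eval_fps G)"
    proof (rule continuous_on_subset[OF continuous_on_eval_fps])
      have "ereal (norm z) < fps_conv_radius G" if "norm z \<le> s" for z :: complex
        using that s(2) by (metis ereal_less_eq(3) le_less_trans)
      thus "cball 0 s \<subseteq> eball (0 :: complex) (fps_conv_radius G)" by auto
    qed
    hence "closed K" unfolding K_def
      by (intro continuous_closed_preimage_constant closed_cball)
    hence "compact K"
      by (metis (no_types, lifting) K_def compact_Int_closed compact_cball inf.absorb_iff2 mem_Collect_eq subsetI)
    then obtain w where w: "w \<in> K" "\<And>z. z \<in> K \<Longrightarrow> norm w \<le> norm z"
      using continuous_attains_inf[OF _ False continuous_on_norm[OF continuous_on_id]] by auto
    have "norm w > 1" using w(1) assms(2)[of w] by (force simp: K_def)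
    moreover have "eval_fps G z \<noteq> 0" if "norm z < norm w" for z
      using w(1) w(2)[of z] that by (auto simp: K_def)
    ultimately show ?thesis by blast
  qed
  then obtain r where r: "1 < r" "\<And>z. norm z < r \<Longrightarrow> eval_fps G z \<noteq> 0" by blast
  have "1 < min (ereal r) (fps_conv_radius G)"
    using r(1) assms(1) by (simp add: one_ereal_def)
  also have "\<dots> \<le> fps_conv_radius (inverse G)"
    using r(2) by (intro fps_conv_radius_inverse) simp
  finally show ?thesis .
qed

subsection \<open>Generating functions of solutions\<close>

text \<open>The library states Cramer's rule for fields only, which excludes power series.\<close>

lemma det_replace_column_mult_vector:
  fixes M :: "'a::comm_ring_1 ^ 'n ^ 'n"
  shows "det (\<chi> i j. if j = k then (M *v x) $ i else M $ i $ j) = x $ k * det M"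
proof -
  \<comment> \<open>Transposing turns the replaced column into a row, where the determinant is
    expanded linearly; a summand with \<open>j \<noteq> k\<close> has row \<open>j\<close> twice and
    vanishes.\<close>
  let ?T = "transpose M"
  have "transpose (\<chi> i j. if j = k then (M *v x) $ i else M $ i $ j) =
      (\<chi> i. if i = k then (\<Sum>j\<in>UNIV. x $ j *s row j ?T) else row i ?T)"
    by (simp add: vec_eq_iff transpose_def row_def matrix_vector_mult_def mult.commute)
  also have "det \<dots> = (\<Sum>j\<in>UNIV. det (\<chi> i. if i = k then x $ j *s row j ?T else row i ?T))"
    by (rule det_linear_row_sum) simp
  also have "\<dots> = (\<Sum>j\<in>UNIV. if j = k then x $ k * det M else 0)"
  proof (intro sum.cong refl)
    fix j
    let ?R = "(\<chi> i. if i = k then row j ?T else row i ?T) :: 'a ^ 'n ^ 'n"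
    have "det (\<chi> i. if i = k then x $ j *s row j ?T else row i ?T) = x $ j * det ?R"
      by (rule det_row_mul)
    moreover have "det ?R = (if j = k then det M else 0)"
    proof (cases "j = k")
      case True
      have "?R = ?T" using True by (simp add: vec_eq_iff row_def)
      thus ?thesis using True by (simp add: det_transpose)
    next
      case False
      have "row j ?R = row k ?R" using False by (simp add: vec_eq_iff row_def)
      thus ?thesis using det_identical_rows[OF False] False by simp
    qed
    ultimately show "det (\<chi> i. if i = k then x $ j *s row j ?T else row i ?T) =
        (if j = k then x $ k * det M else 0)" by simp
  qed
  finally show ?thesis by (simp add: det_transpose)
qed

lemma fps_conv_radius_sum_ge:
  fixes f :: "'i \<Rightarrow> complex fps"
  shows "(\<And>i. i \<in> I \<Longrightarrow> R \<le> fps_conv_radius (f i)) \<Longrightarrow> R \<le> fps_conv_radius (sum f I)"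
  by (induction I rule: infinite_finite_induct) (auto intro: fps_conv_radius_add_ge)

lemma fps_conv_radius_prod_ge:
  fixes f :: "'i \<Rightarrow> complex fps"
  shows "(\<And>i. i \<in> I \<Longrightarrow> R \<le> fps_conv_radius (f i)) \<Longrightarrow> R \<le> fps_conv_radius (prod f I)"
  by (induction I rule: infinite_finite_induct) (auto intro: fps_conv_radius_mult_ge)

lemma fps_conv_radius_det_ge:
  fixes M :: "complex fps ^ 'n ^ 'n"
  assumes "\<And>i j. R \<le> fps_conv_radius (M $ i $ j)"
  shows "R \<le> fps_conv_radius (det M)"
proof -
  have "fps_conv_radius (of_int k :: complex fps) = \<infinity>" for k
    by (simp flip: fps_of_int)
  thus ?thesis
    unfolding det_def
    by (intro fps_conv_radius_sum_ge fps_conv_radius_mult_ge fps_conv_radius_prod_ge assms) simp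
qed

section \<open>The recurrence as a linear system over power series\<close>

lemma Theta_minus: "Theta A u (- int n) = u n"
  using solution_Theta[of A u] by (auto simp: solution_with_initial_condition_def)

text \<open>The series is cut at \<open>l = n\<close>: up to there it is a convolution, beyond it
  only the initial condition enters. The term with \<open>u 0\<close> is the one for
  \<open>l = n\<close> in the convolution, so the second sum starts at \<open>k = 1\<close>.\<close>

lemma Theta_Suc:
  assumes "\<And>k. k > N \<Longrightarrow> u k = 0"
  shows "Theta A u (int (Suc n)) =
    (\<Sum>l\<le>n. A l *v Theta A u (int (n - l))) + (\<Sum>k = 1..N. A (n + k) *v u k)"
proof -
  have past: "Theta A u (int n - int l) = u (l - n)" if "n \<le> l" for l
    using Theta_minus[of A u "l - n"] that by (simp add: of_nat_diff)
  have "Theta A u (int (Suc n)) = (\<Sum>l. A l *v Theta A u (int n - int l))"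
    using solution_Theta[of A u]
    unfolding solution_with_initial_condition_def of_nat_Suc add.commute[of 1] by simp
  also have "\<dots> = (\<Sum>l\<in>{..n} \<union> {n + 1..n + N}. A l *v Theta A u (int n - int l))"
  proof (rule suminf_finite)
    fix l assume l: "l \<notin> {..n} \<union> {n + 1..n + N}"
    thus "A l *v Theta A u (int n - int l) = 0"
      using assms[of "l - n"] past[of l] by (cases "l \<le> n") auto
  qed auto
  also have "\<dots> = (\<Sum>l\<le>n. A l *v Theta A u (int n - int l)) +
      (\<Sum>l\<in>{n + 1..n + N}. A l *v Theta A u (int n - int l))"
    by (rule sum.union_disjoint) auto
  also have "(\<Sum>l\<le>n. A l *v Theta A u (int n - int l)) = (\<Sum>l\<le>n. A l *v Theta A u (int (n - l)))"
    by (intro sum.cong) (auto simp: of_nat_diff)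
  also have "(\<Sum>l\<in>{n + 1..n + N}. A l *v Theta A u (int n - int l)) = (\<Sum>k = 1..N. A (n + k) *v u k)"
    by (rule sum.reindex_bij_witness[of _ "\<lambda>k. n + k" "\<lambda>l. l - n"])
       (auto simp: past)
  finally show ?thesis .
qed

lemma conv_radius_kneading_determinant_mult_solution:
  fixes A :: "nat \<Rightarrow> complex ^ 'p ^ 'p"
  assumes hol: "kneading_matrix_holomorphic A \<rho>" and u: "u \<in> initial_conditions"
  shows "\<rho> \<le> fps_conv_radius (kneading_determinant A * Abs_fps (\<lambda>n. Theta A u (int n) $ \<alpha>))"
proof -
  let ?K = "kneading_matrix A"
  define M where "M = mat 1 - (\<chi> i j. fps_X * ?K $ i $ j)"
  define V where "V = (\<chi> i. Abs_fps (\<lambda>n. Theta A u (int n) $ i))"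
  obtain N where N: "\<And>k. k > N \<Longrightarrow> u k = 0"
    using u finite_nat_set_iff_bounded_le[of "{n. u n \<noteq> 0}"]
    by (auto simp: initial_conditions_def) (meson not_le)
  \<comment> \<open>In the recurrence \<open>u k\<close> meets \<open>A (n + k)\<close>, whence the
    shift by \<open>k\<close>; \<open>fps_X\<close> accounts for the step from \<open>n\<close> to
    \<open>n + 1\<close>. The sum is finite, so \<open>W\<close> converges wherever the kneading
    matrix does.\<close>
  define W where "W = (\<chi> i. fps_const (u 0 $ i) +
    fps_X * (\<Sum>k = 1..N. \<Sum>j\<in>UNIV. fps_const (u k $ j) * fps_shift k (?K $ i $ j)))"
  have MV: "(M *v V) $ i = W $ i" for i
  proof -
    have MV': "(M *v V) $ i = V $ i - fps_X * (\<Sum>j\<in>UNIV. ?K $ i $ j * V $ j)"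
      by (simp add: M_def matrix_vector_mult_diff_rdistrib)
         (simp add: matrix_vector_mult_def sum_distrib_left mult.assoc)
    have K_nth: "fps_nth (?K $ i $ j) n = A n $ i $ j" for j n
      by (simp add: kneading_matrix_def)
    have KV_nth: "fps_nth (?K $ i $ j * V $ j) n = (\<Sum>l\<le>n. A l $ i $ j * Theta A u (int (n - l)) $ j)"
      for j n by (simp add: fps_mult_nth K_nth V_def atLeast0AtMost)
    show ?thesis
    proof (rule fps_ext)
      fix n
      show "fps_nth ((M *v V) $ i) n = fps_nth (W $ i) n"
      proof (cases n)
        case 0
        thus ?thesis using Theta_minus[of A u 0] unfolding MV' by (simp add: W_def V_def)
      next
        case (Suc m)
        have "fps_nth (V $ i) (Suc m) = (\<Sum>l\<le>m. \<Sum>j\<in>UNIV. A l $ i $ j * Theta A u (int (m - l)) $ j)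
            + (\<Sum>k = 1..N. \<Sum>j\<in>UNIV. A (m + k) $ i $ j * u k $ j)"
          using Theta_Suc[where A = A and n = m, OF N] by (simp add: V_def matrix_vector_mult_def)
        also have "(\<Sum>l\<le>m. \<Sum>j\<in>UNIV. A l $ i $ j * Theta A u (int (m - l)) $ j) =
            (\<Sum>j\<in>UNIV. \<Sum>l\<le>m. A l $ i $ j * Theta A u (int (m - l)) $ j)"
          by (rule sum.swap)
        finally show ?thesis
          unfolding Suc MV'
          by (simp add: W_def fps_sum_nth K_nth KV_nth add.commute[of m] mult.commute[of "A _ $ _ $ _"])
      qed
    qed
  qed
  have K: "\<rho> \<le> fps_conv_radius (?K $ i $ j)" for i j
    using hol by (simp add: kneading_matrix_holomorphic_def)
  have rW: "\<rho> \<le> fps_conv_radius (W $ i)" for i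
    by (auto simp: W_def intro!: fps_conv_radius_add_ge fps_conv_radius_mult_ge fps_conv_radius_sum_ge K)
  have rM: "\<rho> \<le> fps_conv_radius (M $ i $ j)" for i j
    by (auto simp: M_def mat_def simp del: diff_0 intro!: fps_conv_radius_diff_ge fps_conv_radius_mult_ge K)
  \<comment> \<open>Cramer's rule removes \<open>V\<close> from the right-hand side: the new column
    is \<open>W\<close>, so every entry has radius at least \<rho>.\<close>
  have "kneading_determinant A * V $ \<alpha> = det (\<chi> i j. if j = \<alpha> then (M *v V) $ i else M $ i $ j)"
    by (simp add: det_replace_column_mult_vector kneading_determinant_def M_def mult.commute)
  also have "\<rho> \<le> fps_conv_radius \<dots>"
    unfolding MV using rW rM by (intro fps_conv_radius_det_ge) auto
  finally show ?thesis by (simp add: V_def)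
qed

section \<open>Assembling the asymptotic expansion\<close>

lemma nth_polar_parts:
  "fps_nth (\<Sum>l\<in>I. \<Sum>j = 1..k l. fps_const (d l j) * inverse (lin (e l) ^ j)) n =
    (\<Sum>l\<in>I. \<Sum>j = 1..k l. d l j * fact (n + j - 1) / (fact (j - 1) * fact n) * e l ^ n)"
  by (auto simp: fps_sum_nth nth_inverse_lin_power intro!: sum.cong)

theorem theorem6:
  fixes A :: "nat \<Rightarrow> complex ^ 'p ^ 'p"
    and \<rho> :: ereal
    and m :: nat
    and eig :: "nat \<Rightarrow> complex"
    and mul :: "nat \<Rightarrow> nat"
    and u :: "nat \<Rightarrow> complex ^ 'p"
    and \<alpha> :: 'p
  assumes "1 < \<rho>"
    and "kneading_matrix_holomorphic A \<rho>"
    and "inj_on eig {1..m}"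
    and "eig ` {1..m} = {\<mu>. \<exists>k. dominant_eigenvalue A \<rho> \<mu> k}"
    and "\<And>i. i \<in> {1..m} \<Longrightarrow> dominant_eigenvalue A \<rho> (eig i) (mul i)"
    and "u \<in> initial_conditions"
  shows "\<exists>!c :: nat \<times> nat \<Rightarrow> complex.
           c \<in> (SIGMA i:{1..m}. {1..mul i}) \<rightarrow>\<^sub>E UNIV \<and>
           (\<lambda>n::nat. Theta A u (int n) $ \<alpha> -
              (\<Sum>i = 1..m. \<Sum>j = 1..mul i.
                 c (i, j) * fact (n + j - 1) / (fact (j - 1) * fact n) * eig i ^ n))
           \<longlonglongrightarrow> 0"
proof -
  define I where "I = {1..m}"
  define \<Delta> where "\<Delta> = kneading_determinant A"
  define V where "V = Abs_fps (\<lambda>n. Theta A u (int n) $ \<alpha>)"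
  have fin: "finite I" by (simp add: I_def)
  have inj: "inj_on eig I" using assms(3) by (simp add: I_def)
  have r\<Delta>: "1 < fps_conv_radius \<Delta>"
    unfolding \<Delta>_def using assms(1) fps_conv_radius_kneading_determinant[OF assms(2)]
    by (rule less_le_trans)
  have eig: "1 \<le> norm (eig i)" "zorder (eval_fps \<Delta>) (inverse (eig i)) = int (mul i)"
    "eventually (\<lambda>z. eval_fps \<Delta> z \<noteq> 0) (at (inverse (eig i)))" if "i \<in> I" for i
  proof -
    have dom: "dominant_eigenvalue A \<rho> (eig i) (mul i)"
      using assms(5) that by (simp add: I_def)
    thus 1: "1 \<le> norm (eig i)" "zorder (eval_fps \<Delta>) (inverse (eig i)) = int (mul i)"
      by (auto simp: dominant_eigenvalue_def generalized_eigenvalue_def \<Delta>_def)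
    have "eval_fps \<Delta> analytic_on {inverse (eig i)}"
      by (intro analytic_at_eval_fps inverse_in_disk 1 r\<Delta>)
    thus "eventually (\<lambda>z. eval_fps \<Delta> z \<noteq> 0) (at (inverse (eig i)))"
      using dom by (simp add: dominant_eigenvalue_def generalized_eigenvalue_def \<Delta>_def
        isolated_zero_analytic_iff)
  qed
  obtain G where G: "fps_conv_radius \<Delta> \<le> fps_conv_radius G"
      "\<Delta> = (\<Prod>i\<in>I. lin (eig i) ^ mul i) * G" "\<And>i. i \<in> I \<Longrightarrow> eval_fps G (inverse (eig i)) \<noteq> 0"
    using fps_factor_zeros[OF fin inj r\<Delta> eig(1) eig(3) eig(2)] by auto
  have rG: "1 < fps_conv_radius G" using r\<Delta> G(1) by (rule less_le_trans)
  \<comment> \<open>A zero of \<open>G\<close> in the closed unit disk is a zero of \<Delta>,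
    nonzero because \<Delta> is 1 at 0. Its reciprocal is then a dominant eigenvalue, hence some
    \<open>eig i\<close>, where \<open>G\<close> does not vanish.\<close>
  have G_nonzero: "eval_fps G z \<noteq> 0" if z: "norm z \<le> 1" for z
  proof
    assume G0: "eval_fps G z = 0"
    have "ereal (norm z) < fps_conv_radius G"
      using z rG by (metis ereal_less_eq(3) one_ereal_def le_less_trans)
    hence \<Delta>0: "eval_fps \<Delta> z = 0"
      unfolding G(2) using G0 by (simp add: eval_fps_mult)
    have "z \<noteq> 0"
      using \<Delta>0 by (auto simp: eval_fps_at_0 \<Delta>_def kneading_determinant_nth_0)
    hence norm: "1 \<le> norm (inverse z)" using z by (simp add: norm_inverse one_le_inverse_iff)
    have \<rho>: "0 < \<rho>" using assms(1) by (rule less_trans[rotated]) simp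
    have "inverse \<rho> < 1"
      using assms(1) by (cases \<rho>) (auto simp: one_ereal_def inverse_less_1_iff)
    also have "1 \<le> ereal (norm (inverse z))" using norm by (simp add: one_ereal_def)
    finally have "\<exists>k. generalized_eigenvalue A \<rho> (inverse z) k"
      using generalized_eigenvalue_iff_zero[OF \<rho> assms(2)] \<Delta>0 by (simp add: \<Delta>_def)
    hence "inverse z \<in> eig ` I"
      unfolding I_def assms(4) using norm by (auto simp: dominant_eigenvalue_def)
    then obtain i where "i \<in> I" "inverse (eig i) = z" by (metis imageE inverse_inverse_eq)
    thus False using G(3) G0 by blast
  qed
  have "1 < fps_conv_radius (\<Delta> * V)"
    unfolding \<Delta>_def V_def using assms(1) conv_radius_kneading_determinant_mult_solution[OF assms(2,6)]
    by (rule less_le_trans)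
  from partial_fractions[OF fin inj eig(1) rG G(3) this[unfolded G(2)]] obtain d V' where
    d: "V = (\<Sum>i\<in>I. \<Sum>j = 1..mul i. fps_const (d i j) * inverse (lin (eig i) ^ j)) + V'"
       "1 < fps_conv_radius (G * V')" by blast
  \<comment> \<open>\<open>V'\<close> is recovered as the product of \<open>inverse G\<close> and
    \<open>G * V'\<close>, both of radius above 1.\<close>
  have "fps_nth G 0 \<noteq> 0" using G_nonzero[of 0] by (simp add: eval_fps_at_0)
  hence V'_eq: "inverse G * (G * V') = V'"
    by (simp add: inverse_mult_eq_1 flip: mult.assoc)
  have "1 < fps_conv_radius (inverse G * (G * V'))"
    by (intro conv_radius_gt_mult fps_conv_radius_inverse_gt_1 rG G_nonzero d(2))
  hence V'_null: "fps_nth V' \<longlonglongrightarrow> 0"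
    unfolding V'_eq by (rule tendsto_nth_of_conv_radius)
  let ?S = "\<lambda>c n. \<Sum>i = 1..m. \<Sum>j = 1..mul i.
    c (i, j) * fact (n + j - 1) / (fact (j - 1) * fact n) * eig i ^ n"
  have S: "?S c n = fps_nth (\<Sum>i\<in>I. \<Sum>j = 1..mul i. fps_const (c (i, j)) * inverse (lin (eig i) ^ j)) n"
    for c n by (simp only: nth_polar_parts I_def)
  show ?thesis
  proof (rule ex_ex1I)
    \<comment> \<open>Outside the index set the value is \<open>undefined\<close>, as the
      extensional function space demands; this makes uniqueness of the whole function
      \<open>c\<close> meaningful.\<close>
    let ?c = "restrict (\<lambda>(i, j). d i j) (SIGMA i:{1..m}. {1..mul i})"
    have "(\<Sum>i\<in>I. \<Sum>j = 1..mul i. fps_const (?c (i, j)) * inverse (lin (eig i) ^ j)) =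
        (\<Sum>i\<in>I. \<Sum>j = 1..mul i. fps_const (d i j) * inverse (lin (eig i) ^ j))"
      by (intro sum.cong) (auto simp: I_def)
    hence "(\<lambda>n. Theta A u (int n) $ \<alpha> - ?S ?c n) = fps_nth V'"
      using d(1) unfolding S by (auto simp: V_def fps_eq_iff algebra_simps)
    thus "\<exists>c. c \<in> (SIGMA i:{1..m}. {1..mul i}) \<rightarrow>\<^sub>E UNIV \<and>
        (\<lambda>n. Theta A u (int n) $ \<alpha> - ?S c n) \<longlonglongrightarrow> 0"
      using V'_null by (intro exI[of _ ?c]) auto
  next
    fix c c' :: "nat \<times> nat \<Rightarrow> complex"
    assume c: "c \<in> (SIGMA i:{1..m}. {1..mul i}) \<rightarrow>\<^sub>E UNIV \<and>
        (\<lambda>n. Theta A u (int n) $ \<alpha> - ?S c n) \<longlonglongrightarrow> 0"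
      and c': "c' \<in> (SIGMA i:{1..m}. {1..mul i}) \<rightarrow>\<^sub>E UNIV \<and>
        (\<lambda>n. Theta A u (int n) $ \<alpha> - ?S c' n) \<longlonglongrightarrow> 0"
    \<comment> \<open>The solution cancels, leaving polar parts with coefficients
      \<open>c (i, j) - c' (i, j)\<close> that tend to 0.\<close>
    have "(\<lambda>n. (Theta A u (int n) $ \<alpha> - ?S c' n) - (Theta A u (int n) $ \<alpha> - ?S c n)) \<longlonglongrightarrow> 0 - 0"
      using c c' by (intro tendsto_diff) auto
    also have "(\<lambda>n. (Theta A u (int n) $ \<alpha> - ?S c' n) - (Theta A u (int n) $ \<alpha> - ?S c n)) =
        fps_nth (\<Sum>i\<in>I. \<Sum>j = 1..mul i. fps_const (c (i, j) - c' (i, j)) * inverse (lin (eig i) ^ j))"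
      unfolding S by (rule ext)
        (simp add: algebra_simps sum_subtractf flip: fps_const_sub)
    finally have "c (i, j) - c' (i, j) = 0" if "i \<in> I" "j \<in> {1..mul i}" for i j
      using polar_parts_unique[where k = mul and d = "\<lambda>i j. c (i, j) - c' (i, j)", OF fin inj eig(1)] that
      by simp
    thus "c = c'"
      using c c' by (intro PiE_ext[of c _ _ c']) (auto simp: I_def)
  qed
qed

end
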